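(* Let $Q_1,Q_2$ be probability distributions on $\mathbb{R}$ with distribution functions $G_1,G_2$, and suppose that $Q_2\ll Q_1$ (i.e. $Q_2$ admits a density with respect to $Q_1$). Then $Q_1\le_{\rm lr}Q_2$ if and only if the ordinal dominance curve $H_{G_1,G_2}$ is convex on the image of $G_1$, i.e. on the set $G_1(\bar{\mathbb{R}})=\{G_1(y):y\in\bar{\mathbb{R}}\}$.
   Context: $\bar{\mathbb{R}}:=[-\infty,\infty]$, and $G_j(-\infty):=0$, $G_j(\infty):=1$. Likelihood ratio order: $Q_1\le_{\rm lr}Q_2$ means that there exist a $\sigma$-finite measure $\mu$ on $\mathbb{R}$ and densities $g_j=\mathrm{d}Q_j/\mathrm{d}\mu:\mathbb{R}\to[0,\infty)$ ($j=1,2$) such that $g_2/g_1$ (with values in $[0,\infty]$, $c/0:=\infty$ for $c>0$) is non-decreasing on $\{g_1+g_2>0\}$. Ordinal dominance curve: $H_{G_1,G_2}:[0,1]\to[0,1]$, $H_{G_1,G_2}(\alpha):=G_2(G_1^{-1}(\alpha))$, where $G_j^{-1}(\alpha):=\min\{y\in\bar{\mathbb{R}}:G_j(y)\ge\alpha\}$. A function $H$ is convex on a set $M\subset[0,1]$ if $\frac{H(s)-H(r)}{s-r}\le\frac{H(t)-H(s)}{t-s}$ for all $r<s<t$ in $M$. *)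

theory Defs
  imports "HOL-Probability.Probability"
begin

definition ext_cdf :: "real measure \<Rightarrow> ereal \<Rightarrow> real" where
  "ext_cdf Q y = (case y of ereal r \<Rightarrow> cdf Q r | PInfty \<Rightarrow> 1 | MInfty \<Rightarrow> 0)"

text \<open>For a probability distribution \<open>Q\<close> and \<open>\<alpha> \<in> [0,1]\<close> the minimum below is attained in
  \<open>[-\<infinity>,\<infinity>]\<close>; in particular the value at \<open>\<alpha> = 0\<close> is \<open>-\<infinity>\<close>.\<close>

definition quantile :: "real measure \<Rightarrow> real \<Rightarrow> ereal" where
  "quantile Q \<alpha> = (LEAST y. ext_cdf Q y \<ge> \<alpha>)"

definition ordinal_dominance_curve :: "real measure \<Rightarrow> real measure \<Rightarrow> real \<Rightarrow> real" where
  "ordinal_dominance_curve Q1 Q2 \<alpha> = ext_cdf Q2 (quantile Q1 \<alpha>)"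

text \<open>Division on \<^typ>\<open>ennreal\<close> satisfies \<open>c / 0 = \<infinity>\<close> for \<open>c > 0\<close>, and \<open>0 / 0\<close> does not occur on the
  set where monotonicity is required.\<close>

definition lr_le :: "real measure \<Rightarrow> real measure \<Rightarrow> bool" where
  "lr_le Q1 Q2 \<longleftrightarrow>
    (\<exists>(\<mu> :: real measure) (g1 :: real \<Rightarrow> real) (g2 :: real \<Rightarrow> real).
      sets \<mu> = sets borel \<and> sigma_finite_measure \<mu> \<and>
      g1 \<in> borel_measurable \<mu> \<and> g2 \<in> borel_measurable \<mu> \<and>
      (\<forall>x. 0 \<le> g1 x) \<and> (\<forall>x. 0 \<le> g2 x) \<and>
      Q1 = density \<mu> (\<lambda>x. ennreal (g1 x)) \<and> Q2 = density \<mu> (\<lambda>x. ennreal (g2 x)) \<and>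
      mono_on {x. g1 x + g2 x > 0} (\<lambda>x. ennreal (g2 x) / ennreal (g1 x)))"

text \<open>The library's \<^const>\<open>convex_on\<close> demands that the domain itself be convex, whereas here it is
  an arbitrary set of reals, such as the image of a distribution function.\<close>

definition slope_convex_on :: "real set \<Rightarrow> (real \<Rightarrow> real) \<Rightarrow> bool" where
  "slope_convex_on M H \<longleftrightarrow>
    (\<forall>r\<in>M. \<forall>s\<in>M. \<forall>t\<in>M. r < s \<and> s < t \<longrightarrow>
      (H s - H r) / (s - r) \<le> (H t - H s) / (t - s))"

end

theory Submission
  imports Defs
begin

text \<open>If \<open>g\<^sub>2/g\<^sub>1\<close> is non-decreasing, then \<open>g\<^sub>2(u) g\<^sub>1(v) \<le> g\<^sub>1(u) g\<^sub>2(v)\<close> for \<open>u < v\<close>; integrating over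
  \<open>(x,y] \<times> (y,z]\<close> gives the comparison of consecutive slopes of the ordinal dominance curve.

  Conversely, let \<open>D\<close> be a density of \<open>Q\<^sub>2\<close> with respect to \<open>Q\<^sub>1\<close>. By convexity, once some interval
  satisfies \<open>Q\<^sub>2(u,v] > c Q\<^sub>1(u,v]\<close>, every interval to its right satisfies \<open>Q\<^sub>2 \<ge> c Q\<^sub>1\<close>. Hence there is
  a threshold \<open>b\<close> with \<open>D \<le> c\<close> almost everywhere on \<open>(-\<infinity>,b)\<close> and \<open>D \<ge> c\<close> almost everywhere on
  \<open>(b,\<infinity>)\<close>. Discarding the exceptional null sets for all rational \<open>c\<close> leaves a set \<open>N\<^sup>c\<close> on which
  \<open>D\<close> itself is non-decreasing, so one can take \<open>\<mu> = Q\<^sub>1\<close>, \<open>g\<^sub>1\<close> the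
  indicator of \<open>N\<^sup>c\<close>, and \<open>g\<^sub>2 = D g\<^sub>1\<close>.\<close>

section \<open>Comparing measures and densities through half-open intervals\<close>

text \<open>\<open>N\<close> is the sum of \<open>M\<close> and the measure with distribution function \<open>cdf N - cdf M\<close>.\<close>

lemma emeasure_le_of_Ioc:
  assumes "finite_borel_measure M" and "finite_borel_measure N"
    and le: "\<And>a b. a < b \<Longrightarrow> measure M {a<..b} \<le> measure N {a<..b}"
    and B: "B \<in> sets borel"
  shows "emeasure M B \<le> emeasure N B"
proof -
  interpret M: finite_borel_measure M by fact
  interpret N: finite_borel_measure N by fact
  define F where "F = (\<lambda>x. cdf N x - cdf M x)"
  define K where "K = interval_measure F"
  have mono_F: "F x \<le> F y" if "x \<le> y" for x y
    using le[of x y] M.cdf_diff_eq[of x y] N.cdf_diff_eq[of x y] that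
    by (cases "x = y") (auto simp: F_def)
  have right_cont_F: "continuous (at_right a) F" for a
    unfolding F_def by (intro continuous_diff M.cdf_is_right_cont N.cdf_is_right_cont)
  have at_bot_F: "(F \<longlongrightarrow> 0) at_bot"
    unfolding F_def using tendsto_diff[OF N.cdf_lim_at_bot M.cdf_lim_at_bot] by simp
  have at_top_F: "(F \<longlongrightarrow> measure N (space N) - measure M (space M)) at_top"
    unfolding F_def by (intro tendsto_diff M.cdf_lim_at_top N.cdf_lim_at_top)
  \<comment> \<open>\<open>F\<close> is non-decreasing with limit 0 at minus infinity, hence
    nonnegative, and so is its limit at plus infinity. This limit is the total mass of the measure
    \<open>K\<close> generated by \<open>F\<close>.\<close>
  have "0 \<le> measure N (space N) - measure M (space M)"
  proof (rule tendsto_lowerbound[OF at_top_F])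
    have "0 \<le> F x" for x
      by (rule tendsto_upperbound[OF at_bot_F])
        (auto intro!: mono_F exI[of _ x] simp: eventually_at_bot_linorder)
    then show "\<forall>\<^sub>F x in at_top. 0 \<le> F x" by simp
  qed simp
  then have K: "finite_borel_measure K"
    unfolding K_def
    by (rule finite_borel_measure_interval_measure[OF mono_F right_cont_F at_bot_F at_top_F, rotated])
  interpret K: finite_borel_measure K by fact
  define S where "S = measure_of UNIV (sets borel) (\<lambda>A. emeasure M A + emeasure K A)"
  have S: "emeasure S A = emeasure M A + emeasure K A" if "A \<in> sets borel" for A
    unfolding S_def
  proof (rule emeasure_measure_of_sigma[OF _ _ _ that])
    show "sigma_algebra UNIV (sets (borel :: real measure))"
      using sets.sigma_algebra_axioms[of "borel :: real measure"] by simp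
    show "countably_additive (sets borel) (\<lambda>A. emeasure M A + emeasure K A)"
    proof (rule countably_additiveI)
      fix A :: "nat \<Rightarrow> real set"
      assume A: "range A \<subseteq> sets borel" "disjoint_family A"
      then have "range A \<subseteq> sets M" "range A \<subseteq> sets K"
        by (simp_all add: M.M_is_borel K.M_is_borel)
      then show "(\<Sum>i. emeasure M (A i) + emeasure K (A i)) = emeasure M (\<Union>i. A i) + emeasure K (\<Union>i. A i)"
        using A by (subst suminf_add[symmetric]) (simp_all add: suminf_emeasure)
    qed
  qed (simp add: positive_def)
  have sets_S: "sets S = sets borel"
    unfolding S_def using sets.sigma_sets_eq[of "borel :: real measure"] by simp
  have S_Ioc: "emeasure S {a<..b} = emeasure N {a<..b}" if "a \<le> b" for a b
  proof -
    have "emeasure S {a<..b} = ennreal (cdf M b - cdf M a) + ennreal (F b - F a)"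
      using that by (simp add: S M.emeasure_Ioc K_def emeasure_interval_measure_Ioc mono_F right_cont_F)
    \<comment> \<open>Both increments are nonnegative, so the extended sum is the real one, and the
      increments of \<open>cdf M\<close> cancel.\<close>
    also have "\<dots> = ennreal (cdf N b - cdf N a)"
      using mono_F[OF that] M.cdf_nondecreasing[OF that]
      by (subst ennreal_plus[symmetric]) (auto simp: F_def)
    finally show ?thesis using that by (simp add: N.emeasure_Ioc)
  qed
  have "S = N"
  proof (rule measure_eqI_generator_eq[where \<Omega>=UNIV])
    fix X assume "X \<in> range (\<lambda>(a, b). {a<..b::real})"
    then obtain a b where Xeq: "X = {a<..b}" by auto
    then show "emeasure S X = emeasure N X"
      by (cases "a \<le> b") (simp_all add: S_Ioc)
  next
    show "(\<Union>i. {- real (i::nat)<..real i}) = UNIV"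
      by (rule UN_Ioc_eq_UNIV)
  qed (auto simp: S_Ioc N.emeasure_Ioc N.M_is_borel sets_S borel_sigma_sets_Ioc Int_stable_def)
  then show ?thesis using S[OF B] by simp
qed

text \<open>Restricting both densities to \<open>{p<..q}\<close> turns the local hypothesis into a
  comparison on all half-open intervals, hence on all Borel sets. Applied to the set
  \<open>B\<close> where the claim fails, it forces the integral of \<open>f - g\<close> over
  \<open>B\<close> to vanish, although \<open>f\<close> exceeds \<open>g\<close> there.\<close>

lemma AE_le_of_Ioc_integral:
  fixes f g :: "real \<Rightarrow> ennreal"
  assumes Q: "sets Q = sets borel"
    and [measurable]: "f \<in> borel_measurable borel" "g \<in> borel_measurable borel"
    and fin: "(\<integral>\<^sup>+x. f x \<partial>Q) < \<infinity>" "(\<integral>\<^sup>+x. g x \<partial>Q) < \<infinity>"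
    and le: "\<And>a b. \<lbrakk>p \<le> a; a < b; b \<le> q\<rbrakk> \<Longrightarrow> emeasure (density Q f) {a<..b} \<le> emeasure (density Q g) {a<..b}"
  shows "AE x in Q. p < x \<and> x \<le> q \<longrightarrow> f x \<le> g x"
proof -
  note [measurable_cong] = Q
  have [simp]: "space Q = UNIV" using sets_eq_imp_space_eq[OF Q] by simp
  define R where "R h = density Q (\<lambda>x. h x * indicator {p<..q} x)" for h :: "real \<Rightarrow> ennreal"
  have R: "emeasure (R h) A = (\<integral>\<^sup>+x. h x * indicator ({p<..q} \<inter> A) x \<partial>Q)"
    if [measurable]: "h \<in> borel_measurable borel" "A \<in> sets borel" for h A
    unfolding R_def by (subst emeasure_density) (auto intro!: nn_integral_cong split: split_indicator)
  have R_finite: "finite_borel_measure (R h)"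
    if [measurable]: "h \<in> borel_measurable borel" and "(\<integral>\<^sup>+x. h x \<partial>Q) < \<infinity>" for h
  proof -
    have "(\<integral>\<^sup>+x. h x * indicator ({p<..q} \<inter> UNIV) x \<partial>Q) \<le> (\<integral>\<^sup>+x. h x \<partial>Q)"
      by (intro nn_integral_mono) (auto split: split_indicator)
    then have "emeasure (R h) UNIV < \<infinity>"
      using that(2) by (simp add: R)
    then show ?thesis
      by (intro finite_borel_measure.intro finite_borel_measure_axioms.intro finite_measureI)
        (auto simp: R_def Q)
  qed
  define B where "B = {x. p < x \<and> x \<le> q \<and> g x < f x}"
  have [measurable]: "B \<in> sets borel" unfolding B_def by measurable
  have "emeasure (R f) B \<le> emeasure (R g) B"
  proof (rule emeasure_le_of_Ioc[OF R_finite R_finite])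
    fix a b :: real assume "a < b"
    have "emeasure (R f) {a<..b} \<le> emeasure (R g) {a<..b}"
    \<comment> \<open>The trace of \<open>{a<..b}\<close> on \<open>{p<..q}\<close> is either an
      interval covered by the hypothesis or empty.\<close>
    proof (cases "max a p < min b q")
      case True
      have "{p<..q} \<inter> {a<..b} = {max a p<..min b q}" by auto
      then show ?thesis
        using le[of "max a p" "min b q"] True by (simp add: R emeasure_density Q)
    next
      case False
      then have "{p<..q} \<inter> {a<..b} = {}" by auto
      then show ?thesis by (simp add: R del: Int_greaterThanAtMost)
    qed
    moreover have "emeasure (R g) {a<..b} < top"
      using finite_borel_measure.axioms(1)[OF R_finite[OF assms(3) fin(2)]]
      by (metis finite_measure.emeasure_finite less_top)
    ultimately show "measure (R f) {a<..b} \<le> measure (R g) {a<..b}"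
      unfolding measure_def by (intro enn2real_mono)
  qed (use fin in simp_all)
  moreover have "{p<..q} \<inter> B = B" by (auto simp: B_def)
  ultimately have le: "(\<integral>\<^sup>+x. f x * indicator B x \<partial>Q) \<le> (\<integral>\<^sup>+x. g x * indicator B x \<partial>Q)"
    by (simp add: R)
  have "(\<integral>\<^sup>+x. g x * indicator B x \<partial>Q) \<le> (\<integral>\<^sup>+x. g x \<partial>Q)"
    by (intro nn_integral_mono) (auto split: split_indicator)
  then have fin_B: "(\<integral>\<^sup>+x. g x * indicator B x \<partial>Q) \<noteq> \<infinity>"
    using fin(2) by auto
  \<comment> \<open>The integral of the difference splits because \<open>g \<le> f\<close> on
    \<open>B\<close> and the subtracted integral is finite.\<close>
  have "(\<integral>\<^sup>+x. f x * indicator B x - g x * indicator B x \<partial>Q) = 0"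
  proof (subst nn_integral_diff)
    show "AE x in Q. g x * indicator B x \<le> f x * indicator B x"
      by (auto simp: B_def split: split_indicator)
  qed (use le fin_B in \<open>auto simp: diff_eq_0_iff_ennreal less_top[symmetric] top_unique\<close>)
  then have "AE x in Q. f x * indicator B x - g x * indicator B x = 0"
    by (rule nn_integral_0_iff_AE[THEN iffD1, rotated]) measurable
  then show ?thesis
  proof (rule AE_mp, intro AE_I2 impI)
    fix x assume "f x * indicator B x - g x * indicator B x = 0" "p < x \<and> x \<le> q"
    then show "f x \<le> g x"
      by (cases "x \<in> B") (auto simp: ennreal_minus_eq_0 B_def not_less)
  qed
qed

section \<open>Extended distribution functions and quantiles\<close>

lemma ext_cdf_eq_measure:
  assumes "real_distribution Q"
  shows "ext_cdf Q y = measure Q {u. ereal u \<le> y}"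
proof -
  interpret real_distribution Q by fact
  show ?thesis
    using prob_space by (cases y) (auto simp: ext_cdf_def cdf_def atMost_def)
qed

lemma ext_cdf_mono:
  assumes "real_distribution Q" and "x \<le> y"
  shows "ext_cdf Q x \<le> ext_cdf Q y"
proof -
  interpret real_distribution Q by fact
  show ?thesis
    unfolding ext_cdf_eq_measure[OF assms(1)] using assms(2)
    by (intro finite_measure_mono) auto
qed

lemma ext_cdf_diff:
  assumes "real_distribution Q" and "x \<le> y"
  shows "ext_cdf Q y - ext_cdf Q x = measure Q {u. x < ereal u \<and> ereal u \<le> y}"
proof -
  interpret real_distribution Q by fact
  have "{u. ereal u \<le> y} - {u. ereal u \<le> x} = {u. x < ereal u \<and> ereal u \<le> y}" by auto
  moreover have "{u. ereal u \<le> z} \<in> sets Q" for z by simp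
  moreover have "{u. ereal u \<le> x} \<subseteq> {u. ereal u \<le> y}" using assms(2) by (auto intro: order_trans)
  ultimately show ?thesis
    unfolding ext_cdf_eq_measure[OF assms(1)] by (metis finite_measure_Diff)
qed

text \<open>A point with value \<open>\<alpha>\<close> lies in the set over which the quantile
  minimizes, so the quantile is below it and monotonicity excludes a value above
  \<open>\<alpha>\<close>. It remains to see that the minimum is attained.\<close>

lemma ext_cdf_quantile:
  assumes "real_distribution Q" and "\<alpha> \<in> range (ext_cdf Q)"
  shows "ext_cdf Q (quantile Q \<alpha>) = \<alpha>" and "\<And>y. ext_cdf Q y = \<alpha> \<Longrightarrow> quantile Q \<alpha> \<le> y"
proof -
  interpret real_distribution Q by fact
  define S where "S = {y. \<alpha> \<le> ext_cdf Q y}"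
  obtain y where y: "\<alpha> = ext_cdf Q y" using assms(2) by auto
  then have "\<alpha> \<le> 1" by (simp add: y ext_cdf_eq_measure[OF assms(1)])
  have up: "\<alpha> \<le> ext_cdf Q z" if "Inf S < z" for z
    using that ext_cdf_mono[OF assms(1), of _ z] by (auto simp: Inf_less_iff S_def intro: order_trans less_imp_le)
  \<comment> \<open>A real infimum is attained by right-continuity and an infimum at plus infinity
    because the value there is 1. An infimum at minus infinity forces
    \<open>\<alpha> \<le> 0\<close>, since the distribution function tends to 0, which is also the
    value there.\<close>
  have *: "\<alpha> \<le> ext_cdf Q (Inf S)"
  proof (cases "Inf S")
    case (real r)
    have "(cdf Q \<longlongrightarrow> cdf Q r) (at_right r)"
      using cdf_is_right_cont by (simp add: continuous_within)
    moreover have "eventually (\<lambda>u. \<alpha> \<le> cdf Q u) (at_right r)"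
      using up[of "ereal _"] real by (auto simp: eventually_at_filter ext_cdf_def)
    ultimately have "\<alpha> \<le> cdf Q r"
      by (intro tendsto_lowerbound) auto
    then show ?thesis by (simp add: real ext_cdf_def)
  next
    case PInf
    then show ?thesis using \<open>\<alpha> \<le> 1\<close> by (simp add: ext_cdf_def)
  next
    case MInf
    then have "\<alpha> \<le> cdf Q u" for u using up[of "ereal u"] by (simp add: ext_cdf_def)
    then have "\<alpha> \<le> 0"
      by (intro tendsto_lowerbound[OF cdf_lim_at_bot]) auto
    then show ?thesis by (simp add: MInf ext_cdf_def)
  qed
  have q: "quantile Q \<alpha> = Inf S"
    unfolding quantile_def by (rule Least_equality) (use * in \<open>auto simp: S_def intro: Inf_lower\<close>)
  show "quantile Q \<alpha> \<le> z" if "ext_cdf Q z = \<alpha>" for z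
    unfolding q using that by (intro Inf_lower) (simp add: S_def)
  then have "ext_cdf Q (quantile Q \<alpha>) \<le> \<alpha>"
    using ext_cdf_mono[OF assms(1)] y by metis
  with * q show "ext_cdf Q (quantile Q \<alpha>) = \<alpha>" by simp
qed


section \<open>From the likelihood ratio order to convexity\<close>

lemma cross_mult_of_ratio_mono:
  fixes g1 g2 :: "real \<Rightarrow> real"
  assumes nonneg: "\<And>x. 0 \<le> g1 x" "\<And>x. 0 \<le> g2 x"
    and mono: "mono_on {x. g1 x + g2 x > 0} (\<lambda>x. ennreal (g2 x) / ennreal (g1 x))"
    and "u < v"
  shows "g2 u * g1 v \<le> g1 u * g2 v"
proof (cases "g1 u + g2 u > 0 \<and> g1 v + g2 v > 0")
  case False
  then have "(g1 u = 0 \<and> g2 u = 0) \<or> (g1 v = 0 \<and> g2 v = 0)"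
    using nonneg[of u] nonneg[of v] by linarith
  then show ?thesis by auto
next
  case True
  then have le: "ennreal (g2 u) / ennreal (g1 u) \<le> ennreal (g2 v) / ennreal (g1 v)"
    using mono \<open>u < v\<close> by (auto simp: mono_on_def)
  consider "g1 v = 0" | "g1 v > 0" "g1 u = 0" | "g1 v > 0" "g1 u > 0"
    using nonneg(1)[of u] nonneg(1)[of v] by linarith
  then show ?thesis
  proof cases
    case 1
    then show ?thesis using nonneg by simp
  next
    case 2
    \<comment> \<open>Here \<open>g2 u > 0\<close>, so the ratio is infinite at \<open>u\<close> but
      finite at \<open>v\<close>: monotonicity rules this case out.\<close>
    then have "ennreal (g2 u) / ennreal (g1 u) = \<infinity>"
      using True by simp
    moreover have "ennreal (g2 v) / ennreal (g1 v) = ennreal (g2 v / g1 v)"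
      using 2 nonneg by (simp add: divide_ennreal)
    ultimately show ?thesis using le by (simp add: top_unique)
  next
    case 3
    then have "g2 u / g1 u \<le> g2 v / g1 v"
      using le nonneg by (simp add: divide_ennreal)
    then show ?thesis using 3 by (simp add: divide_simps mult.commute)
  qed
qed

text \<open>Each product of masses is an iterated integral over \<open>A\<close> and
  \<open>B\<close>, so the pointwise inequality can be integrated.\<close>

lemma emeasure_cross_mult_le:
  fixes f g :: "'a \<Rightarrow> ennreal"
  assumes [measurable]: "f \<in> borel_measurable M" "g \<in> borel_measurable M" "A \<in> sets M" "B \<in> sets M"
    and le: "\<And>u v. u \<in> A \<Longrightarrow> v \<in> B \<Longrightarrow> g u * f v \<le> f u * g v"
  shows "emeasure (density M g) A * emeasure (density M f) B
    \<le> emeasure (density M f) A * emeasure (density M g) B"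
proof -
  have prod: "emeasure (density M h) A * emeasure (density M k) B =
      (\<integral>\<^sup>+u. \<integral>\<^sup>+v. h u * indicator A u * (k v * indicator B v) \<partial>M \<partial>M)"
    if [measurable]: "h \<in> borel_measurable M" "k \<in> borel_measurable M" for h k
    by (simp add: emeasure_density nn_integral_cmult nn_integral_multc)
  show ?thesis
    by (simp only: prod assms(1,2)) (intro nn_integral_mono, auto simp: le split: split_indicator)
qed

lemma slope_convex_of_lr_le:
  assumes Q1: "real_distribution Q1" and Q2: "real_distribution Q2" and "lr_le Q1 Q2"
  shows "slope_convex_on (range (ext_cdf Q1)) (ordinal_dominance_curve Q1 Q2)"
proof -
  interpret Q1: real_distribution Q1 by fact
  interpret Q2: real_distribution Q2 by fact
  obtain \<mu> :: "real measure" and g1 g2 :: "real \<Rightarrow> real" where sets: "sets \<mu> = sets borel"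
    and [measurable]: "g1 \<in> borel_measurable \<mu>" "g2 \<in> borel_measurable \<mu>"
    and nonneg: "\<And>x. 0 \<le> g1 x" "\<And>x. 0 \<le> g2 x"
    and dens: "Q1 = density \<mu> (\<lambda>x. ennreal (g1 x))" "Q2 = density \<mu> (\<lambda>x. ennreal (g2 x))"
    and mono: "mono_on {x. g1 x + g2 x > 0} (\<lambda>x. ennreal (g2 x) / ennreal (g1 x))"
    using assms(3) unfolding lr_le_def by blast
  have cross: "measure Q2 A * measure Q1 B \<le> measure Q1 A * measure Q2 B"
    if "A \<in> sets borel" "B \<in> sets borel" and less: "\<And>u v. u \<in> A \<Longrightarrow> v \<in> B \<Longrightarrow> u < v" for A B
  proof -
    have "emeasure Q2 A * emeasure Q1 B \<le> emeasure Q1 A * emeasure Q2 B"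
      unfolding dens
    proof (rule emeasure_cross_mult_le)
      fix u v assume "u \<in> A" "v \<in> B"
      then have "g2 u * g1 v \<le> g1 u * g2 v"
        using cross_mult_of_ratio_mono[OF nonneg mono] less by blast
      then show "ennreal (g2 u) * ennreal (g1 v) \<le> ennreal (g1 u) * ennreal (g2 v)"
        using nonneg by (simp flip: ennreal_mult)
    qed (use that sets in simp_all)
    then show ?thesis
      by (simp add: Q1.emeasure_eq_measure Q2.emeasure_eq_measure flip: ennreal_mult)
  qed
  show ?thesis
    unfolding slope_convex_on_def
  proof (intro ballI impI)
    fix r s t assume in_range: "r \<in> range (ext_cdf Q1)" "s \<in> range (ext_cdf Q1)" "t \<in> range (ext_cdf Q1)"
      and "r < s \<and> s < t"
    then have "r < s" "s < t" by simp_all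
    \<comment> \<open>As \<open>r\<close>, \<open>s\<close>, \<open>t\<close> are values of
      \<open>ext_cdf Q1\<close>, their quantiles attain them exactly. The increments of the
      arguments are thus \<open>Q1\<close>-masses of the sets \<open>A\<close> and \<open>B\<close>
      below, and those of the curve are their \<open>Q2\<close>-masses.\<close>
    define x y z where "x = quantile Q1 r" and "y = quantile Q1 s" and "z = quantile Q1 t"
    note G1 = ext_cdf_quantile(1)[OF Q1 in_range(1), folded x_def]
      ext_cdf_quantile(1)[OF Q1 in_range(2), folded y_def]
      ext_cdf_quantile(1)[OF Q1 in_range(3), folded z_def]
    have "x \<le> y" "y \<le> z"
      using ext_cdf_mono[OF Q1, of y x] ext_cdf_mono[OF Q1, of z y] G1 \<open>r < s\<close> \<open>s < t\<close>
      by (meson linorder_le_cases not_le)+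
    define A B where "A = {u. x < ereal u \<and> ereal u \<le> y}" and "B = {u. y < ereal u \<and> ereal u \<le> z}"
    have diffs: "s - r = measure Q1 A" "t - s = measure Q1 B"
      "ext_cdf Q2 y - ext_cdf Q2 x = measure Q2 A" "ext_cdf Q2 z - ext_cdf Q2 y = measure Q2 B"
      unfolding A_def B_def using \<open>x \<le> y\<close> \<open>y \<le> z\<close> G1
      by (simp_all flip: ext_cdf_diff[OF Q1] ext_cdf_diff[OF Q2])
    have "u < v" if "u \<in> A" "v \<in> B" for u v
    proof -
      have "ereal u < ereal v" using that unfolding A_def B_def by (blast intro: le_less_trans)
      then show ?thesis by simp
    qed
    then have "measure Q2 A * measure Q1 B \<le> measure Q1 A * measure Q2 B"
      by (intro cross) (simp_all add: A_def B_def)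
    moreover have "0 < measure Q1 A" "0 < measure Q1 B"
      using diffs \<open>r < s\<close> \<open>s < t\<close> by linarith+
    ultimately have "measure Q2 A / measure Q1 A \<le> measure Q2 B / measure Q1 B"
      by (simp add: divide_simps mult.commute)
    then show "(ordinal_dominance_curve Q1 Q2 s - ordinal_dominance_curve Q1 Q2 r) / (s - r)
        \<le> (ordinal_dominance_curve Q1 Q2 t - ordinal_dominance_curve Q1 Q2 s) / (t - s)"
      unfolding ordinal_dominance_curve_def x_def[symmetric] y_def[symmetric] z_def[symmetric] diffs .
  qed
qed

section \<open>From convexity to the likelihood ratio order\<close>

text \<open>When there is a gap between \<open>r\<close> and \<open>s\<close>, the slope from
  \<open>r\<close> to \<open>s\<close> lies between the two slopes.\<close>

lemma slope_convex_on_slope_mono: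
  assumes convex: "slope_convex_on M H" and "p \<in> M" "r \<in> M" "s \<in> M" "t \<in> M"
    and "p < r" "r \<le> s" "s < t"
  shows "(H r - H p) / (r - p) \<le> (H t - H s) / (t - s)"
proof (cases "r = s")
  case True
  then show ?thesis using assms unfolding slope_convex_on_def by blast
next
  case False
  then have "r < s" using \<open>r \<le> s\<close> by simp
  then have "(H r - H p) / (r - p) \<le> (H s - H r) / (s - r)"
    using assms unfolding slope_convex_on_def by blast
  also have "\<dots> \<le> (H t - H s) / (t - s)"
    using assms \<open>r < s\<close> unfolding slope_convex_on_def by blast
  finally show ?thesis .
qed

text \<open>If \<open>x < y\<close> but \<open>D y < D x\<close>, a rational \<open>c\<close>
  strictly between these values has a threshold that is both at most \<open>x\<close> and at least
  \<open>y\<close>. Rational levels suffice, so only countably many null sets are discarded.\<close>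

lemma AE_monotone_of_thresholds:
  fixes D :: "real \<Rightarrow> real"
  assumes nonneg: "\<And>x. 0 \<le> D x"
    and threshold: "\<And>c. 0 \<le> c \<Longrightarrow>
      \<exists>b::ereal. AE x in Q. (ereal x < b \<longrightarrow> D x \<le> c) \<and> (b < ereal x \<longrightarrow> c \<le> D x)"
  obtains N where "N \<in> null_sets Q" and "mono_on (space Q - N) D"
proof -
  obtain b :: "real \<Rightarrow> ereal" where b: "\<And>c. 0 \<le> c \<Longrightarrow>
      AE x in Q. (ereal x < b c \<longrightarrow> D x \<le> c) \<and> (b c < ereal x \<longrightarrow> c \<le> D x)"
    using choice[of "\<lambda>c b. 0 \<le> c \<longrightarrow> (AE x in Q. (ereal x < b \<longrightarrow> D x \<le> c) \<and> (b < ereal x \<longrightarrow> c \<le> D x))"]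
      threshold by blast
  have "AE x in Q. \<forall>c::rat. 0 \<le> c \<longrightarrow>
      (ereal x < b (of_rat c) \<longrightarrow> D x \<le> of_rat c) \<and> (b (of_rat c) < ereal x \<longrightarrow> of_rat c \<le> D x)"
    unfolding AE_all_countable using b by (auto simp: zero_le_of_rat_iff)
  then obtain N where "N \<in> null_sets Q"
    and N: "\<And>x c. \<lbrakk>x \<in> space Q - N; 0 \<le> c\<rbrakk> \<Longrightarrow>
      (ereal x < b (of_rat c) \<longrightarrow> D x \<le> of_rat c) \<and> (b (of_rat c) < ereal x \<longrightarrow> of_rat c \<le> D x)"
    by (elim AE_E3) blast
  moreover have "mono_on (space Q - N) D"
  proof (rule mono_onI, rule ccontr)
    fix x y assume *: "x \<in> space Q - N" "y \<in> space Q - N" "x \<le> y" and "\<not> D x \<le> D y"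
    then have "x < y" by (cases "x = y") auto
    obtain c where c: "D y < of_rat c" "of_rat c < D x"
      using \<open>\<not> D x \<le> D y\<close> of_rat_dense[of "D y" "D x"] by auto
    then have "0 < real_of_rat c" using nonneg[of y] by linarith
    then have "0 \<le> c" by simp
    have "\<not> ereal x < b (of_rat c)" "\<not> b (of_rat c) < ereal y"
      using N[OF *(1) \<open>0 \<le> c\<close>] N[OF *(2) \<open>0 \<le> c\<close>] c by auto
    then have "ereal y \<le> ereal x" by (meson not_less order_trans)
    with \<open>x < y\<close> show False by simp
  qed
  ultimately show ?thesis using that by blast
qed

lemma lr_le_of_slope_convex:
  assumes Q1: "real_distribution Q1" and Q2: "real_distribution Q2"
    and ac: "absolutely_continuous Q1 Q2"
    and convex: "slope_convex_on (range (ext_cdf Q1)) (ordinal_dominance_curve Q1 Q2)"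
  shows "lr_le Q1 Q2"
proof -
  interpret Q1: real_distribution Q1 by fact
  interpret Q2: real_distribution Q2 by fact
  define H where "H = ordinal_dominance_curve Q1 Q2"
  define G1 G2 where "G1 = cdf Q1" and "G2 = cdf Q2"
  have range: "G1 x \<in> range (ext_cdf Q1)" for x
    by (rule range_eqI[of _ _ "ereal x"]) (simp add: ext_cdf_def G1_def)
  have ac_measure: "measure Q2 A = 0" if "measure Q1 A = 0" "A \<in> sets borel" for A
    using ac that unfolding absolutely_continuous_def null_sets_def
    by (auto simp: Q1.emeasure_eq_measure Q2.emeasure_eq_measure)
  \<comment> \<open>The quantile \<open>q\<close> may lie strictly to the left of \<open>x\<close>,
    but then \<open>Q1\<close> does not charge the interval between them, and by absolute continuity
    neither does \<open>Q2\<close>.\<close>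
  have H_G1: "H (G1 x) = G2 x" for x
  proof -
    define q where "q = quantile Q1 (G1 x)"
    have "ext_cdf Q1 q = ext_cdf Q1 (ereal x)" "q \<le> ereal x"
      using ext_cdf_quantile[OF Q1 range[of x]] by (simp_all add: q_def ext_cdf_def G1_def)
    then have "ext_cdf Q2 (ereal x) - ext_cdf Q2 q = 0"
      using ext_cdf_diff[OF Q1, of q "ereal x"] ext_cdf_diff[OF Q2, of q "ereal x"]
      by (simp add: ac_measure)
    then show ?thesis
      by (simp add: H_def ordinal_dominance_curve_def q_def ext_cdf_def G2_def)
  qed
  obtain D where [measurable]: "D \<in> borel_measurable Q1"
    and D: "AE x in Q1. RN_deriv Q1 Q2 x = ennreal (D x)"
    and nonneg: "\<And>x. 0 \<le> D x"
    using Q1.real_RN_deriv[OF Q2.finite_measure_axioms ac] by auto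
  have "Q2 = density Q1 (RN_deriv Q1 Q2)"
    using Q1.density_RN_deriv[OF ac] by simp
  also have "\<dots> = density Q1 (\<lambda>x. ennreal (D x))"
    using D by (intro density_cong) auto
  finally have Q2_eq: "Q2 = density Q1 (\<lambda>x. ennreal (D x))" .
  have D_Ioc: "emeasure (density Q1 (\<lambda>x. ennreal (D x))) {u<..v} = ennreal (G2 v - G2 u)" if "u < v" for u v
    using that unfolding Q2_eq[symmetric] by (simp add: Q2.emeasure_Ioc G2_def)
  have c_Ioc: "emeasure (density Q1 (\<lambda>x. ennreal c)) {u<..v} = ennreal (c * (G1 v - G1 u))"
    if "u < v" "0 \<le> c" for u v c
    using that by (simp add: emeasure_density nn_integral_cmult Q1.emeasure_Ioc G1_def ennreal_mult')
  have D_finite: "(\<integral>\<^sup>+x. ennreal (D x) \<partial>Q1) < \<infinity>"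
    using Q2.emeasure_space_1 arg_cong[OF Q2_eq, of "\<lambda>M. emeasure M UNIV"]
    by (simp add: emeasure_density)
  have c_finite: "(\<integral>\<^sup>+x. ennreal c \<partial>Q1) < \<infinity>" for c
    using Q1.emeasure_space_1 by (simp add: ennreal_mult_less_top)
  have "\<exists>b::ereal. AE x in Q1. (ereal x < b \<longrightarrow> D x \<le> c) \<and> (b < ereal x \<longrightarrow> c \<le> D x)"
    if "0 \<le> c" for c
  proof -
    \<comment> \<open>\<open>W\<close> collects the right endpoints of the intervals on which
      \<open>Q2\<close> exceeds \<open>c\<close> times \<open>Q1\<close>. The threshold is extended
      real: it is plus infinity if there are none, and minus infinity if they are unbounded
      below.\<close>
    define W where "W = {v. \<exists>u<v. c * (G1 v - G1 u) < G2 v - G2 u}"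
    define b where "b = Inf (ereal ` W)"
    have left: "G2 v - G2 u \<le> c * (G1 v - G1 u)" if "u < v" "ereal v < b" for u v
    proof -
      have "v \<notin> W" using that(2) by (auto simp: b_def not_le[symmetric] intro: Inf_lower)
      then show ?thesis using that(1) unfolding W_def mem_Collect_eq by (meson not_le)
    qed
    have right: "c * (G1 v - G1 u) \<le> G2 v - G2 u" if "b < ereal u" "u < v" for u v
    proof (cases "G1 u = G1 v")
      \<comment> \<open>The slope over an interval without \<open>Q1\<close>-mass is undefined, but
        such an interval has no \<open>Q2\<close>-mass either.\<close>
      case True
      then have "G2 u = G2 v" by (metis H_G1)
      with True show ?thesis by simp
    next
      case False
      have G1_mono: "G1 x \<le> G1 y" if "x \<le> y" for x y
        using that by (simp add: G1_def Q1.cdf_nondecreasing)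
      \<comment> \<open>Since \<open>b\<close> is below \<open>u\<close>, some interval of slope
        greater than \<open>c\<close> ends before \<open>u\<close>; convexity passes this bound on
        to the interval from \<open>u\<close> to \<open>v\<close>.\<close>
      obtain v0 u0 where "v0 < u" "u0 < v0" and less: "c * (G1 v0 - G1 u0) < G2 v0 - G2 u0"
        using \<open>b < ereal u\<close> by (auto simp: b_def Inf_less_iff W_def)
      then have "G1 u0 \<noteq> G1 v0" using H_G1[of u0] H_G1[of v0] by auto
      then have "G1 u0 < G1 v0" "G1 v0 \<le> G1 u" "G1 u < G1 v"
        using G1_mono[of u0 v0] G1_mono[of v0 u] G1_mono[of u v] False \<open>u0 < v0\<close> \<open>v0 < u\<close> \<open>u < v\<close>
        by auto
      then have "(G2 v0 - G2 u0) / (G1 v0 - G1 u0) \<le> (G2 v - G2 u) / (G1 v - G1 u)"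
        using slope_convex_on_slope_mono[OF convex range range range range, folded H_def] H_G1 by metis
      moreover have "c < (G2 v0 - G2 u0) / (G1 v0 - G1 u0)"
        using less \<open>G1 u0 < G1 v0\<close> by (simp add: pos_less_divide_eq)
      ultimately have "c < (G2 v - G2 u) / (G1 v - G1 u)" by simp
      then show ?thesis using \<open>G1 u < G1 v\<close> by (simp add: pos_less_divide_eq)
    qed
    have AE_left: "AE x in Q1. p < x \<and> x \<le> q \<longrightarrow> ennreal (D x) \<le> ennreal c" if "ereal q < b" for p q
    proof (rule AE_le_of_Ioc_integral[OF Q1.events_eq_borel _ _ D_finite c_finite])
      fix u v assume "p \<le> u" "u < v" "v \<le> q"
      then have "ereal v < b" using that by (meson ereal_less_eq(3) le_less_trans)
      then show "emeasure (density Q1 (\<lambda>x. ennreal (D x))) {u<..v} \<le> emeasure (density Q1 (\<lambda>x. ennreal c)) {u<..v}"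
        using \<open>u < v\<close> left \<open>0 \<le> c\<close> by (simp add: D_Ioc c_Ioc ennreal_leI)
    qed simp_all
    have AE_right: "AE x in Q1. p < x \<and> x \<le> q \<longrightarrow> ennreal c \<le> ennreal (D x)" if "b < ereal p" for p q
    proof (rule AE_le_of_Ioc_integral[OF Q1.events_eq_borel _ _ c_finite D_finite])
      fix u v assume "p \<le> u" "u < v" "v \<le> q"
      then have "b < ereal u" using that by (meson ereal_less_eq(3) less_le_trans)
      then show "emeasure (density Q1 (\<lambda>x. ennreal c)) {u<..v} \<le> emeasure (density Q1 (\<lambda>x. ennreal (D x))) {u<..v}"
        using \<open>u < v\<close> right \<open>0 \<le> c\<close> by (simp add: D_Ioc c_Ioc ennreal_leI)
    qed simp_all
    \<comment> \<open>Rational endpoints exhaust the open half-lines on both sides of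
      \<open>b\<close> by countably many bounded intervals, so the exceptional sets still have union
      of measure 0.\<close>
    have "AE x in Q1. \<forall>p q :: rat.
        (ereal (of_rat q) < b \<longrightarrow> of_rat p < x \<and> x \<le> of_rat q \<longrightarrow> D x \<le> c) \<and>
        (b < ereal (of_rat p) \<longrightarrow> of_rat p < x \<and> x \<le> of_rat q \<longrightarrow> c \<le> D x)"
      unfolding AE_all_countable AE_conj_iff using AE_left AE_right nonneg \<open>0 \<le> c\<close>
      by (auto simp: ennreal_le_iff)
    then have "AE x in Q1. (ereal x < b \<longrightarrow> D x \<le> c) \<and> (b < ereal x \<longrightarrow> c \<le> D x)"
    proof (rule AE_mp, intro AE_I2 impI conjI)
      fix x
      assume *: "\<forall>p q :: rat.
        (ereal (of_rat q) < b \<longrightarrow> of_rat p < x \<and> x \<le> of_rat q \<longrightarrow> D x \<le> c) \<and>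
        (b < ereal (of_rat p) \<longrightarrow> of_rat p < x \<and> x \<le> of_rat q \<longrightarrow> c \<le> D x)"
      \<comment> \<open>These supply the outer endpoint of the bounded interval, on the side of
        \<open>x\<close> away from \<open>b\<close>.\<close>
      obtain p0 q0 where "of_rat p0 < x" "x < of_rat q0"
        using of_rat_dense[of "x - 1" x] of_rat_dense[of x "x + 1"] by auto
      show "D x \<le> c" if "ereal x < b"
      proof -
        obtain q where "ereal x < ereal (of_rat q)" "ereal (of_rat q) < b"
          using ereal_dense3[OF \<open>ereal x < b\<close>] by auto
        then show ?thesis using * \<open>of_rat p0 < x\<close> by (auto intro: less_imp_le)
      qed
      show "c \<le> D x" if "b < ereal x"
      proof -
        obtain p where "b < ereal (of_rat p)" "ereal (of_rat p) < ereal x"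
          using ereal_dense3[OF \<open>b < ereal x\<close>] by auto
        then show ?thesis using * \<open>x < of_rat q0\<close> by (auto intro: less_imp_le)
      qed
    qed
    then show ?thesis by blast
  qed
  from AE_monotone_of_thresholds[OF nonneg this] obtain N
    where N: "N \<in> null_sets Q1" and mono: "mono_on (space Q1 - N) D" by blast
  have [measurable]: "N \<in> sets borel" using N by auto
  \<comment> \<open>Both densities vanish on \<open>N\<close> and \<open>g1\<close> is 1 elsewhere,
    so \<open>g1 + g2\<close> is positive exactly off \<open>N\<close>, where the ratio equals
    \<open>D\<close>.\<close>
  define g1 g2 where "g1 = (indicator (- N) :: real \<Rightarrow> real)" and "g2 = (\<lambda>x. D x * indicator (- N) x)"
  have AE_N: "AE x in Q1. x \<notin> N" using N by (rule AE_not_in)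
  show ?thesis
    unfolding lr_le_def
  proof (intro exI conjI)
    have "density Q1 (\<lambda>x. ennreal (g1 x)) = density Q1 (\<lambda>x. 1)"
      using AE_N by (intro density_cong) (auto simp: g1_def)
    then show "Q1 = density Q1 (\<lambda>x. ennreal (g1 x))" by (simp add: density_1)
    show "Q2 = density Q1 (\<lambda>x. ennreal (g2 x))"
      unfolding Q2_eq using AE_N by (intro density_cong) (auto simp: g2_def)
    show "mono_on {x. g1 x + g2 x > 0} (\<lambda>x. ennreal (g2 x) / ennreal (g1 x))"
    proof (rule mono_onI)
      fix x y assume "x \<in> {x. g1 x + g2 x > 0}" "y \<in> {x. g1 x + g2 x > 0}" "x \<le> y"
      moreover from this have "x \<notin> N" "y \<notin> N"
        by (auto simp: g1_def g2_def)
      ultimately show "ennreal (g2 x) / ennreal (g1 x) \<le> ennreal (g2 y) / ennreal (g1 y)"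
        using mono by (auto simp: g1_def g2_def mono_on_def intro!: divide_right_mono_ennreal ennreal_leI)
    qed
  qed (use nonneg Q1.sigma_finite_measure_axioms in \<open>auto simp: g1_def g2_def\<close>)
qed

theorem corollary8:
  fixes Q1 Q2 :: "real measure"
  assumes "real_distribution Q1" and "real_distribution Q2"
    and "absolutely_continuous Q1 Q2"
  shows "lr_le Q1 Q2 \<longleftrightarrow>
    slope_convex_on (range (ext_cdf Q1)) (ordinal_dominance_curve Q1 Q2)"
  using slope_convex_of_lr_le lr_le_of_slope_convex assms by blast

end
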